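(* There is a function $\varepsilon:\mathbb{N}\to\mathbb{R}$ with $\varepsilon(n)\to 0$ as $n\to\infty$ such that the following holds for every $n\in\mathbb{N}$: if $\mathcal{A}\subset\mathcal{P}[n]$ is a family of subsets of $[n]=\{1,\ldots,n\}$ such that $|A\setminus B|\neq 1$ for all $A,B\in\mathcal{A}$, then \[ |\mathcal{A}| \le \frac{2+\varepsilon(n)}{n}\binom{n}{\lfloor n/2\rfloor}. \] (That is, $|\mathcal{A}|\le \frac{2+o(1)}{n}\binom{n}{\lfloor n/2\rfloor}$.)
   Context: $\mathcal{P}[n]$ denotes the power set of $[n]=\{1,\ldots,n\}$. The $o(1)$ term tends to $0$ as $n\to\infty$ and does not depend on the family $\mathcal{A}$. *)

theory Defs
  imports Complex_Main
begin

end

theory Submission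
  imports Defs "HOL-Probability.Hoeffding" "HOL-Real_Asymp.Real_Asymp"
begin

text \<open>Take a chain \<open>C\<^sub>0 \<subset> C\<^sub>1 \<subset> \<dots>\<close> of subsets of a \<open>b\<close>-set \<open>D\<close> and points \<open>x, y \<notin> D\<close>. If
  \<open>C\<^sub>i \<union> {x}\<close> and \<open>C\<^sub>j \<union> {y}\<close> with \<open>i \<le> j\<close> both lie in the family, then \<open>x = y\<close>, as otherwise the
  difference is \<open>{x}\<close>. So only one of the \<open>n - b\<close> points outside \<open>D\<close> occurs. Two family members
  \<open>C\<^sub>i \<union> {x} \<subset> C\<^sub>j \<union> {x}\<close> are rare for a random chain: inside a fixed set \<open>B\<close>, layer \<open>k\<close> of the
  family has density at most \<open>1 / (k + 1)\<close>, because its members have disjoint upper shadows.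
  Restricting to the layers within \<open>n powr (3/4)\<close> of the middle, the expected number of pairs
  \<open>(i, x)\<close> with \<open>C\<^sub>i \<union> {x}\<close> in the family is \<open>1 + o(1)\<close>, while each layer contributes about \<open>n / 2\<close>
  times its density; the remaining layers are negligible by Hoeffding's inequality.\<close>

section \<open>Random maximal chains and an LYM inequality corrected by pairs\<close>

text \<open>When \<open>D\<close> is not counted, a random maximal chain of \<open>D\<close> passes
  through \<open>D - {y}\<close> for a uniform \<open>y\<close>, so its expected weight is the mean
  over all deletions. With d = \<open>card D\<close>, a set \<open>F\<close> of size k survives d -
  k deletions, and (d - k) * C(d, k) = d * C(d - 1, k).\<close>

lemma sum_average_over_deletions:
  fixes h :: "'a set \<Rightarrow> real"
  assumes fin: "finite D" and D: "D \<notin> \<F>"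
  shows "(\<Sum>F | F \<in> \<F> \<and> F \<subseteq> D. h F / real (card D choose card F)) =
    (\<Sum>y\<in>D. \<Sum>F | F \<in> \<F> \<and> F \<subseteq> D - {y}. h F / real ((card D - 1) choose card F)) / real (card D)"
proof -
  let ?d = "card D"
  have finF: "finite {F. F \<in> \<F> \<and> F \<subseteq> D}"
    by (rule finite_subset[of _ "Pow D"]) (use fin in auto)
  have "(\<Sum>y\<in>D. \<Sum>F | F \<in> \<F> \<and> F \<subseteq> D - {y}. h F / real ((?d - 1) choose card F)) =
      (\<Sum>y\<in>D. \<Sum>F | F \<in> {F. F \<in> \<F> \<and> F \<subseteq> D} \<and> y \<notin> F. h F / real ((?d - 1) choose card F))"
    by (intro sum.cong) auto
  also have "\<dots> = (\<Sum>F | F \<in> \<F> \<and> F \<subseteq> D. \<Sum>y | y \<in> D \<and> y \<notin> F. h F / real ((?d - 1) choose card F))"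
    by (rule sum.swap_restrict[OF fin finF])
  also have "\<dots> = (\<Sum>F | F \<in> \<F> \<and> F \<subseteq> D. real ?d * (h F / real (?d choose card F)))"
  proof (rule sum.cong[OF refl])
    fix F assume "F \<in> {F. F \<in> \<F> \<and> F \<subseteq> D}"
    then have F: "F \<subseteq> D" "F \<noteq> D" using D by auto
    then have lt: "card F < ?d" using fin by (meson psubsetI psubset_card_mono)
    have eq: "{y. y \<in> D \<and> y \<notin> F} = D - F" by auto
    have "card {y. y \<in> D \<and> y \<notin> F} = ?d - card F"
      unfolding eq using F(1) fin by (simp add: card_Diff_subset finite_subset)
    moreover have "real (?d - card F) * real (?d choose card F) = real ?d * real ((?d - 1) choose card F)"
      using binomial_absorb_comp[of ?d "card F"] by (metis of_nat_mult)
    moreover have "(?d - 1) choose card F > 0" "?d choose card F > 0"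
      using lt by (auto simp: zero_less_binomial_iff)
    ultimately show "(\<Sum>y | y \<in> D \<and> y \<notin> F. h F / real ((?d - 1) choose card F)) =
        real ?d * (h F / real (?d choose card F))"
      by (simp add: field_simps)
  qed
  also have "\<dots> = real ?d * (\<Sum>F | F \<in> \<F> \<and> F \<subseteq> D. h F / real (?d choose card F))"
    by (simp add: sum_distrib_left)
  finally have *: "(\<Sum>y\<in>D. \<Sum>F | F \<in> \<F> \<and> F \<subseteq> D - {y}. h F / real ((?d - 1) choose card F)) =
      real ?d * (\<Sum>F | F \<in> \<F> \<and> F \<subseteq> D. h F / real (?d choose card F))" .
  show ?thesis
  proof (cases "D = {}")
    case True
    then have "{F. F \<in> \<F> \<and> F \<subseteq> D} = {}" using D by auto
    then show ?thesis by (simp only: sum.empty True card.empty) simp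
  next
    case False
    then show ?thesis using fin unfolding * by simp
  qed
qed

text \<open>A uniformly random maximal chain of subsets of \<open>D\<close> meets \<open>\<F>\<close> in a number \<open>N\<close> of sets, and
  \<open>N \<le> 1 + (N choose 2)\<close>; taking expectations gives the inequality.\<close>

lemma LYM_with_pairs:
  fixes D :: "'a set"
  assumes "finite D"
  shows "(\<Sum>F | F \<in> \<F> \<and> F \<subseteq> D. 1 / real (card D choose card F)) \<le>
    1 + (\<Sum>F | F \<in> \<F> \<and> F \<subseteq> D.
          (\<Sum>E | E \<in> \<F> \<and> E \<subset> F. 1 / real (card F choose card E)) / real (card D choose card F))"
  using assms
proof (induction "card D" arbitrary: D rule: less_induct)
  case less
  define p where "p = (\<lambda>F. \<Sum>E | E \<in> \<F> \<and> E \<subset> F. 1 / real (card F choose card E))"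
  let ?S = "{F. F \<in> \<F> \<and> F \<subseteq> D}"
  have p_nonneg: "p F \<ge> 0" for F unfolding p_def by (intro sum_nonneg) auto
  show ?case
  proof (cases "D \<in> \<F>")
    case True
    \<comment> \<open>Every maximal chain contains \<open>D\<close>, which gives the 1. The
      remaining members are those below \<open>D\<close>, with total \<open>p D\<close>, and this is
      the term \<open>F = D\<close> on the right.\<close>
    have split: "?S = insert D {F. F \<in> \<F> \<and> F \<subset> D}" using True by auto
    have fin: "finite {F. F \<in> \<F> \<and> F \<subset> D}"
      by (rule finite_subset[of _ "Pow D"]) (use less.prems in auto)
    have "(\<Sum>F\<in>?S. 1 / real (card D choose card F)) = 1 + p D"
      unfolding split using fin by (subst sum.insert) (auto simp: p_def)
    also have "p D \<le> (\<Sum>F\<in>?S. p F / real (card D choose card F))"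
      unfolding split using fin by (subst sum.insert) (auto intro!: sum_nonneg simp: p_nonneg)
    finally show ?thesis by (simp add: p_def)
  next
    case False
    show ?thesis
    proof (cases "D = {}")
      case True
      then have "?S = {}" using False by auto
      then show ?thesis by (simp only: sum.empty)
    next
      case ne: False
      then have d: "card D > 0" using less.prems by (simp add: card_gt_0_iff)
      \<comment> \<open>Since \<open>p F\<close> does not depend on the ambient set, the induction
        hypotheses for all \<open>D - {y}\<close> can be averaged.\<close>
      have "(\<Sum>F | F \<in> \<F> \<and> F \<subseteq> D - {y}. 1 / real ((card D - 1) choose card F)) \<le>
          1 + (\<Sum>F | F \<in> \<F> \<and> F \<subseteq> D - {y}. p F / real ((card D - 1) choose card F))"
        if "y \<in> D" for y
        using less.hyps[of "D - {y}"] that less.prems d by (simp add: p_def)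
      then have "(\<Sum>y\<in>D. \<Sum>F | F \<in> \<F> \<and> F \<subseteq> D - {y}. 1 / real ((card D - 1) choose card F)) \<le>
          (\<Sum>y\<in>D. 1 + (\<Sum>F | F \<in> \<F> \<and> F \<subseteq> D - {y}. p F / real ((card D - 1) choose card F)))"
        by (intro sum_mono)
      then have "real (card D) * (\<Sum>F\<in>?S. 1 / real (card D choose card F)) \<le>
          real (card D) * (1 + (\<Sum>F\<in>?S. p F / real (card D choose card F)))"
        using d sum_average_over_deletions[OF less.prems False, of "\<lambda>_. 1"]
          sum_average_over_deletions[OF less.prems False, of p]
        by (simp add: sum.distrib field_simps)
      then show ?thesis using d by (simp add: p_def)
    qed
  qed
qed

section \<open>Density of the family below a fixed set\<close>

text \<open>With b = \<open>card B\<close>, each member of the layer has b - k extensions by one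
  point, and no extension is shared. Hence the layer has at most C(b, k + 1) / (b - k) = C(b, k) /
  (k + 1) members.\<close>

lemma layer_density_le:
  fixes \<A> :: "'a set set"
  assumes fin: "finite B" and k: "k < card B"
    and sep: "\<And>A A'. A \<in> \<A> \<Longrightarrow> A' \<in> \<A> \<Longrightarrow> card (A - A') \<noteq> 1"
  shows "real (card {A \<in> \<A>. A \<subseteq> B \<and> card A = k}) / real (card B choose k) \<le> 1 / real (k + 1)"
proof -
  define L where "L = {A \<in> \<A>. A \<subseteq> B \<and> card A = k}"
  let ?b = "card B"
  have finL: "finite L" unfolding L_def by (rule finite_subset[of _ "Pow B"]) (use fin in auto)
  have finA: "finite A" if "A \<in> L" for A using that fin unfolding L_def by (auto intro: finite_subset)
  have inj: "inj_on (\<lambda>(A, x). insert x A) (Sigma L (\<lambda>A. B - A))"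
  proof (rule inj_onI, clarify)
    fix A x A' y
    assume A: "A \<in> L" "x \<in> B" "x \<notin> A" and A': "A' \<in> L" "y \<in> B" "y \<notin> A'"
      and eq: "insert x A = insert y A'"
    have "A = A'"
    proof (rule ccontr)
      assume "A \<noteq> A'"
      moreover have "card A = card A'" using A(1) A'(1) by (simp add: L_def)
      \<comment> \<open>Equal sizes make \<open>A - A'\<close> nonempty, while a common extension
        leaves only \<open>y\<close> as a possible element: the forbidden singleton
        difference.\<close>
      ultimately have "\<not> A \<subseteq> A'" using card_subset_eq[OF finA[OF A'(1)], of A] by blast
      moreover have "A - A' \<subseteq> {y}" using eq by auto
      ultimately have "A - A' = {y}" by auto
      then show False using sep[of A A'] A A' by (auto simp: L_def)
    qed
    then show "A = A' \<and> x = y" using eq A A' by auto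
  qed
  have "card (Sigma L (\<lambda>A. B - A)) \<le> card {S. S \<subseteq> B \<and> card S = k + 1}"
  proof (rule card_inj_on_le[OF inj])
    show "(\<lambda>(A, x). insert x A) ` Sigma L (\<lambda>A. B - A) \<subseteq> {S. S \<subseteq> B \<and> card S = k + 1}"
    proof (clarify, intro conjI)
      fix A x assume A: "A \<in> L" "x \<in> B" "x \<notin> A"
      then show "insert x A \<subseteq> B" by (auto simp: L_def)
      show "card (insert x A) = k + 1" using A finA[OF A(1)] by (simp add: L_def)
    qed
    show "finite {S. S \<subseteq> B \<and> card S = k + 1}"
      by (rule finite_subset[of _ "Pow B"]) (use fin in auto)
  qed
  moreover have "card (Sigma L (\<lambda>A. B - A)) = card L * (?b - k)"
  proof -
    have "card (B - A) = ?b - k" if "A \<in> L" for A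
      using that fin by (auto simp: L_def card_Diff_subset finite_subset)
    then show ?thesis using finL fin by (simp add: card_SigmaI)
  qed
  ultimately have "card L * (?b - k) \<le> ?b choose (k + 1)" using fin by (simp add: n_subsets)
  then have "card L * (?b - k) * (k + 1) \<le> (?b choose (k + 1)) * (k + 1)" by (rule mult_le_mono1)
  also have "\<dots> = (?b choose k) * (?b - k)"
    using binomial_absorption[of k ?b] binomial_absorb_comp[of ?b k] by (simp add: mult.commute)
  finally have "card L * (k + 1) * (?b - k) \<le> (?b choose k) * (?b - k)" by (simp only: mult_ac)
  then have "card L * (k + 1) \<le> ?b choose k" using k by (simp only: mult_le_cancel2 zero_less_diff)
  then have "real (card L) * real (k + 1) \<le> real (?b choose k)" by (metis of_nat_le_iff of_nat_mult)
  moreover have "?b choose k > 0" using k by (simp add: zero_less_binomial_iff)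
  ultimately show ?thesis unfolding L_def[symmetric] by (simp add: field_simps)
qed

text \<open>The sum is the expected number of members strictly below \<open>B\<close> on a random
  maximal chain of \<open>B\<close>. They lie in at most \<open>b - a\<close> layers, each of
  density at most 1 / (a + 1).\<close>

lemma proper_subsets_density_le:
  fixes \<A> :: "'a set set"
  assumes fin: "finite B" and B: "card B \<le> b" and a: "\<And>A. A \<in> \<A> \<Longrightarrow> a \<le> card A"
    and sep: "\<And>A A'. A \<in> \<A> \<Longrightarrow> A' \<in> \<A> \<Longrightarrow> card (A - A') \<noteq> 1"
  shows "(\<Sum>A | A \<in> \<A> \<and> A \<subset> B. 1 / real (card B choose card A)) \<le> real (b - a) / real (a + 1)"
proof -
  let ?S = "{A. A \<in> \<A> \<and> A \<subset> B}"
  have finS: "finite ?S" by (rule finite_subset[of _ "Pow B"]) (use fin in auto)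
  have "(\<Sum>A\<in>?S. 1 / real (card B choose card A)) =
      (\<Sum>k\<in>{a..<card B}. \<Sum>A | A \<in> ?S \<and> card A = k. 1 / real (card B choose card A))"
    by (rule sum.group[symmetric]) (use finS a fin in \<open>auto intro: psubset_card_mono\<close>)
  also have "\<dots> \<le> (\<Sum>k\<in>{a..<card B}. 1 / real (a + 1))"
  proof (rule sum_mono)
    fix k assume k: "k \<in> {a..<card B}"
    have eq: "{A. A \<in> ?S \<and> card A = k} = {A \<in> \<A>. A \<subseteq> B \<and> card A = k}" using k by auto
    have "(\<Sum>A | A \<in> ?S \<and> card A = k. 1 / real (card B choose card A)) =
        real (card {A \<in> \<A>. A \<subseteq> B \<and> card A = k}) / real (card B choose k)"
      unfolding eq by simp
    also have "\<dots> \<le> 1 / real (k + 1)" by (rule layer_density_le[OF fin _ sep]) (use k in auto)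
    also have "\<dots> \<le> 1 / real (a + 1)" using k by (intro divide_left_mono) auto
    finally show "(\<Sum>A | A \<in> ?S \<and> card A = k. 1 / real (card B choose card A)) \<le> 1 / real (a + 1)" .
  qed
  also have "\<dots> = real (card B - a) / real (a + 1)" by simp
  also have "\<dots> \<le> real (b - a) / real (a + 1)" using B by (intro divide_right_mono) auto
  finally show ?thesis .
qed

section \<open>Double counting over chains with one outside point\<close>

text \<open>Such a \<open>D\<close> is determined by \<open>D - A\<close>, an arbitrary subset of
  \<open>V - A\<close> of the right size. As \<open>D\<close> contains all of \<open>A\<close>
  except \<open>x\<close>, that size is b - (card A - 1).\<close>

lemma card_supersets_avoiding_point:
  assumes fin: "finite V" and A: "A \<subseteq> V" "x \<in> A" and b: "card A \<le> b"
  shows "card {D. D \<subseteq> V \<and> card D = b \<and> x \<notin> D \<and> A - {x} \<subseteq> D} =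
    (card V - card A) choose (b + 1 - card A)"
proof -
  have finA: "finite A" using fin A by (auto intro: finite_subset)
  then have cA: "card A \<ge> 1" using A by (metis One_nat_def Suc_leI card_gt_0_iff empty_iff)
  have "bij_betw (\<lambda>E. E \<union> (A - {x})) {E. E \<subseteq> V - A \<and> card E = b + 1 - card A}
      {D. D \<subseteq> V \<and> card D = b \<and> x \<notin> D \<and> A - {x} \<subseteq> D}"
  proof (rule bij_betw_byWitness[where f' = "\<lambda>D. D - A"])
    show "(\<lambda>E. E \<union> (A - {x})) ` {E. E \<subseteq> V - A \<and> card E = b + 1 - card A}
        \<subseteq> {D. D \<subseteq> V \<and> card D = b \<and> x \<notin> D \<and> A - {x} \<subseteq> D}"
    proof clarify
      fix E assume E: "E \<subseteq> V - A" "card E = b + 1 - card A"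
      then have "card (E \<union> (A - {x})) = card E + card (A - {x})"
        using fin finA by (intro card_Un_disjoint) (auto intro: finite_subset)
      then show "E \<union> (A - {x}) \<subseteq> V \<and> card (E \<union> (A - {x})) = b \<and> x \<notin> E \<union> (A - {x})
          \<and> A - {x} \<subseteq> E \<union> (A - {x})"
        using E A b cA by auto
    qed
    show "(\<lambda>D. D - A) ` {D. D \<subseteq> V \<and> card D = b \<and> x \<notin> D \<and> A - {x} \<subseteq> D}
        \<subseteq> {E. E \<subseteq> V - A \<and> card E = b + 1 - card A}"
    proof clarify
      fix D assume D: "D \<subseteq> V" "x \<notin> D" "A - {x} \<subseteq> D" "b = card D"
      have "D - A = D - (A - {x})" using D by auto
      then have "card (D - A) = card D - card (A - {x})"
        using D finA by (simp add: card_Diff_subset)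
      then show "D - A \<subseteq> V - A \<and> card (D - A) = card D + 1 - card A" using D A cA by auto
    qed
  qed (use A in auto)
  then have "card {D. D \<subseteq> V \<and> card D = b \<and> x \<notin> D \<and> A - {x} \<subseteq> D} =
      card {E. E \<subseteq> V - A \<and> card E = b + 1 - card A}"
    by (rule bij_betw_same_card[symmetric])
  also have "\<dots> = (card V - card A) choose (b + 1 - card A)"
    using fin finA A by (simp add: n_subsets card_Diff_subset)
  finally show ?thesis .
qed

text \<open>Both sides count triples (A, x, D) in an n-set with |A| = k, |D| = b, x in A but not in
  D, and A - {x} inside D: on the left A is chosen first, on the right D.\<close>

lemma choose_exchange:
  assumes "1 \<le> k" "k \<le> b" "b \<le> n"
  shows "k * ((n - k) choose (b + 1 - k)) * (n choose k) = (n - b) * (n choose b) * (b choose (k - 1))"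
proof -
  obtain i where i: "k = Suc i" using assms by (cases k) auto
  have 1: "Suc i * (n choose Suc i) = (n - i) * (n choose i)"
    using binomial_absorption[of i n] binomial_absorb_comp[of n i] by simp
  have 2: "(n choose b) * (b choose i) = (n choose i) * ((n - i) choose (b - i))"
    using assms i by (intro choose_mult) auto
  have 3: "(n - b) * ((n - i) choose (b - i)) = (n - i) * ((n - k) choose (b - i))"
    using binomial_absorb_comp[of "n - i" "b - i"] assms i by simp
  have "k * ((n - k) choose (b + 1 - k)) * (n choose k) =
      (Suc i * (n choose Suc i)) * ((n - k) choose (b - i))"
    unfolding i by (simp only: mult_ac diff_Suc_Suc add.commute[of b 1] plus_1_eq_Suc)
  also have "\<dots> = ((n - i) * ((n - k) choose (b - i))) * (n choose i)"
    unfolding 1 by (simp only: mult_ac)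
  also have "\<dots> = (n - b) * ((n choose b) * (b choose i))" unfolding 2 3[symmetric] by simp
  finally show ?thesis using i by (simp add: mult_ac)
qed

text \<open>For a random \<open>b\<close>-set \<open>D\<close> and a random maximal chain of
  \<open>D\<close>, the expected number of pairs (A, x) with \<open>A - {x}\<close> on the chain and
  \<open>x\<close> outside \<open>D\<close> is (n - b) times the sum. The expected number of nested
  couples of such pairs is at most (b - a) / (a + 1) times as large, so the pair-corrected LYM
  inequality gives the bound.\<close>

lemma reciprocal_binomial_sum_le:
  fixes \<A> :: "'a set set"
  assumes fin: "finite V" and V: "card V = n" and \<A>: "\<A> \<subseteq> Pow V"
    and a: "1 \<le> a" and ab: "a \<le> b" and b: "b < n"
    and layers: "\<And>A. A \<in> \<A> \<Longrightarrow> a \<le> card A \<and> card A \<le> b"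
    and sep: "\<And>A A'. A \<in> \<A> \<Longrightarrow> A' \<in> \<A> \<Longrightarrow> card (A - A') \<noteq> 1"
  shows "(1 - real (b - a) / real (a + 1)) * real (n - b) * (\<Sum>A\<in>\<A>. 1 / real (n choose card A)) \<le> 1"
proof -
  define \<eta> where "\<eta> = real (b - a) / real (a + 1)"
  define \<D> where "\<D> = {D. D \<subseteq> V \<and> card D = b}"
  \<comment> \<open>\<open>R B x\<close> is the expected number of sets \<open>A - {x}\<close>
    strictly below \<open>B - {x}\<close> on a random chain of \<open>B - {x}\<close>; it does not
    involve \<open>D\<close>. \<open>w k\<close> is the total weight that a pair (A, x) with |A| = k
    receives from all \<open>D\<close>.\<close>
  define T where "T D = {(A, x). A \<in> \<A> \<and> x \<in> A \<and> x \<notin> D \<and> A - {x} \<subseteq> D}" for D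
  define R where "R B x = (\<Sum>A | A \<in> \<A> \<and> A \<subset> B \<and> x \<in> A. 1 / real ((card B - 1) choose (card A - 1)))" for B x
  define w where "w k = real (n - b) * real (n choose b) / (real (n choose k) * real k)" for k
  have fin\<A>: "finite \<A>" using \<A> fin by (auto intro: finite_subset)
  have finA: "finite A" if "A \<in> \<A>" for A using that \<A> fin by (auto intro: finite_subset)
  have fin\<D>: "finite \<D>" unfolding \<D>_def by (rule finite_subset[of _ "Pow V"]) (use fin in auto)
  have posA: "card A > 0" if "A \<in> \<A>" for A using layers[OF that] a by auto

  \<comment> \<open>If the points differed, \<open>x\<close> would lie outside \<open>B\<close>,
    being neither \<open>y\<close> nor in \<open>D\<close>, and \<open>A - B\<close> would be
    \<open>{x}\<close>. The case of equal sets gives injectivity, the case of nested sets identifies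
    what lies below \<open>B - {x}\<close>.\<close>
  have same_point: "x = y" if "A \<in> \<A>" "B \<in> \<A>" "x \<in> A" "x \<notin> D" "y \<notin> D" "B - {y} \<subseteq> D" "A - {x} \<subseteq> B - {y}"
    for A B x y D
  proof (rule ccontr)
    assume "x \<noteq> y"
    then have "A - B = {x}" using that by auto
    then show False using sep[OF that(1,2)] by simp
  qed

  \<comment> \<open>The corrected LYM inequality is applied to the sets \<open>A - {x}\<close>. By
    \<open>same_point\<close> everything below \<open>B - {x}\<close> has the same removed point
    \<open>x\<close>, so the inner sum is at most \<open>R B x\<close>.\<close>
  have chain: "(\<Sum>(A, x)\<in>T D. 1 / real (b choose (card A - 1))) \<le>
      1 + (\<Sum>(B, x)\<in>T D. R B x / real (b choose (card B - 1)))" if D: "D \<in> \<D>" for D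
  proof -
    let ?f = "\<lambda>(A, x). A - {x}"
    define \<F> where "\<F> = ?f ` T D"
    have finD: "finite D" and cD: "card D = b" using D fin unfolding \<D>_def by (auto intro: finite_subset)
    have \<F>D: "{F. F \<in> \<F> \<and> F \<subseteq> D} = \<F>" unfolding \<F>_def T_def by auto
    have inj: "inj_on ?f (T D)"
    proof (rule inj_onI, clarify)
      fix A x B y assume *: "(A, x) \<in> T D" "(B, y) \<in> T D" "A - {x} = B - {y}"
      then have "x = y" by (intro same_point[of A B x D y]) (auto simp: T_def)
      with * show "A = B \<and> x = y" by (auto simp: T_def)
    qed
    have card_f: "card (A - {x}) = card A - 1" if "(A, x) \<in> T D" for A x
      using that by (auto simp: T_def)
    have "(\<Sum>(A, x)\<in>T D. 1 / real (b choose (card A - 1))) = (\<Sum>F\<in>\<F>. 1 / real (card D choose card F))"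
      unfolding \<F>_def cD by (subst sum.reindex[OF inj]) (auto intro!: sum.cong simp: card_f)
    also have "\<dots> \<le> 1 + (\<Sum>F\<in>\<F>.
        (\<Sum>E | E \<in> \<F> \<and> E \<subset> F. 1 / real (card F choose card E)) / real (card D choose card F))"
      using LYM_with_pairs[OF finD, of \<F>] unfolding \<F>D .
    also have "(\<Sum>F\<in>\<F>. (\<Sum>E | E \<in> \<F> \<and> E \<subset> F. 1 / real (card F choose card E)) / real (card D choose card F)) =
        (\<Sum>(B, x)\<in>T D. (\<Sum>E | E \<in> \<F> \<and> E \<subset> B - {x}. 1 / real (card (B - {x}) choose card E))
            / real (b choose (card B - 1)))"
      unfolding \<F>_def[symmetric] cD
      by (subst (2) \<F>_def, subst sum.reindex[OF inj]) (auto intro!: sum.cong simp: card_f)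
    also have "\<dots> \<le> (\<Sum>(B, x)\<in>T D. R B x / real (b choose (card B - 1)))"
    proof -
      have "(\<Sum>E | E \<in> \<F> \<and> E \<subset> B - {x}. 1 / real (card (B - {x}) choose card E)) \<le> R B x"
        if Bx: "(B, x) \<in> T D" for B x
      proof -
        let ?P = "{A. A \<in> \<A> \<and> A \<subset> B \<and> x \<in> A}"
        have sub: "{E. E \<in> \<F> \<and> E \<subset> B - {x}} \<subseteq> (\<lambda>A. A - {x}) ` ?P"
        proof (rule subsetI)
          fix E assume "E \<in> {E. E \<in> \<F> \<and> E \<subset> B - {x}}"
          then have E: "E \<in> \<F>" "E \<subset> B - {x}" by auto
          then obtain A y where A: "(A, y) \<in> T D" "E = A - {y}" unfolding \<F>_def by auto
          then have "y = x" using Bx E by (intro same_point[of A B y D x]) (auto simp: T_def)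
          then show "E \<in> (\<lambda>A. A - {x}) ` ?P" using A E Bx by (intro image_eqI[of _ _ A]) (auto simp: T_def)
        qed
        have injP: "inj_on (\<lambda>A. A - {x}) ?P" by (rule inj_onI) auto
        have "(\<Sum>E | E \<in> \<F> \<and> E \<subset> B - {x}. 1 / real (card (B - {x}) choose card E)) \<le>
            (\<Sum>E\<in>(\<lambda>A. A - {x}) ` ?P. 1 / real (card (B - {x}) choose card E))"
          using fin\<A> by (intro sum_mono2[OF _ sub]) auto
        also have "\<dots> = R B x"
          unfolding R_def using card_f[OF Bx] by (subst sum.reindex[OF injP]) (auto intro!: sum.cong)
        finally show ?thesis .
      qed
      then show ?thesis by (intro sum_mono) (auto intro!: divide_right_mono)
    qed
    finally show ?thesis by simp
  qed

  \<comment> \<open>Exchanging the sums, a pair (A, x) is weighted by the number of admissible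
    \<open>D\<close> over the binomial; \<open>choose_exchange\<close> shows that this depends only
    on \<open>card A\<close>.\<close>
  have count: "(\<Sum>D\<in>\<D>. \<Sum>(A, x)\<in>T D. g A x / real (b choose (card A - 1))) =
      (\<Sum>A\<in>\<A>. w (card A) * (\<Sum>x\<in>A. g A x))" for g :: "'a set \<Rightarrow> 'a \<Rightarrow> real"
  proof -
    let ?U = "Sigma \<A> (\<lambda>A. A)"
    have finU: "finite ?U" using fin\<A> finA by auto
    have "(\<Sum>D\<in>\<D>. \<Sum>(A, x)\<in>T D. g A x / real (b choose (card A - 1))) =
        (\<Sum>D\<in>\<D>. \<Sum>p | p \<in> ?U \<and> snd p \<notin> D \<and> fst p - {snd p} \<subseteq> D.
           g (fst p) (snd p) / real (b choose (card (fst p) - 1)))"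
      by (intro sum.cong) (auto simp: T_def)
    also have "\<dots> = (\<Sum>p\<in>?U. \<Sum>D | D \<in> \<D> \<and> snd p \<notin> D \<and> fst p - {snd p} \<subseteq> D.
           g (fst p) (snd p) / real (b choose (card (fst p) - 1)))"
      by (rule sum.swap_restrict[OF fin\<D> finU])
    also have "\<dots> = (\<Sum>(A, x)\<in>?U. w (card A) * g A x)"
    proof (rule sum.cong[OF refl], clarify)
      fix A x assume A: "A \<in> \<A>" "x \<in> A"
      let ?k = "card A"
      have k: "1 \<le> ?k" "?k \<le> b" using layers[OF A(1)] a by auto
      have "{D. D \<in> \<D> \<and> x \<notin> D \<and> A - {x} \<subseteq> D} = {D. D \<subseteq> V \<and> card D = b \<and> x \<notin> D \<and> A - {x} \<subseteq> D}"
        unfolding \<D>_def by auto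
      then have c: "card {D. D \<in> \<D> \<and> x \<notin> D \<and> A - {x} \<subseteq> D} = (n - ?k) choose (b + 1 - ?k)"
        using card_supersets_avoiding_point[OF fin, of A x b] A \<A> k V by auto
      have "real ?k * real ((n - ?k) choose (b + 1 - ?k)) * real (n choose ?k) =
          real (n - b) * real (n choose b) * real (b choose (?k - 1))"
        using choose_exchange[of ?k b n] k b by (metis less_imp_le_nat of_nat_mult)
      moreover have "n choose ?k > 0" "b choose (?k - 1) > 0"
        using k b by (auto simp: zero_less_binomial_iff)
      ultimately have "real ((n - ?k) choose (b + 1 - ?k)) / real (b choose (?k - 1)) = w ?k"
        unfolding w_def using k by (simp add: field_simps)
      then show "(\<Sum>D | D \<in> \<D> \<and> snd (A, x) \<notin> D \<and> fst (A, x) - {snd (A, x)} \<subseteq> D.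
           g (fst (A, x)) (snd (A, x)) / real (b choose (card (fst (A, x)) - 1))) = w ?k * g A x"
        by (simp add: c) (metis times_divide_eq_left mult.commute)
    qed
    also have "\<dots> = (\<Sum>A\<in>\<A>. w (card A) * (\<Sum>x\<in>A. g A x))"
      using fin\<A> finA by (subst sum.Sigma[symmetric]) (auto simp: sum_distrib_left)
    finally show ?thesis .
  qed

  \<comment> \<open>Summing over \<open>x\<close> counts each \<open>A\<close> exactly
    \<open>card A\<close> times, and |A| / C(|B| - 1, |A| - 1) = |B| / C(|B|, |A|) restores the
    density of \<open>\<A>\<close> below \<open>B\<close>.\<close>
  have R_le: "(\<Sum>x\<in>B. R B x) \<le> real (card B) * \<eta>" if B: "B \<in> \<A>" for B
  proof -
    have finS: "finite {A. A \<in> \<A> \<and> A \<subset> B}" using fin\<A> by auto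
    have "(\<Sum>x\<in>B. R B x) = (\<Sum>x\<in>B. \<Sum>A | A \<in> {A. A \<in> \<A> \<and> A \<subset> B} \<and> x \<in> A.
        1 / real ((card B - 1) choose (card A - 1)))"
      unfolding R_def by (intro sum.cong) auto
    also have "\<dots> = (\<Sum>A | A \<in> \<A> \<and> A \<subset> B. \<Sum>x | x \<in> B \<and> x \<in> A. 1 / real ((card B - 1) choose (card A - 1)))"
      by (rule sum.swap_restrict[OF finA[OF B] finS])
    also have "\<dots> = (\<Sum>A | A \<in> \<A> \<and> A \<subset> B. real (card B) * (1 / real (card B choose card A)))"
    proof (rule sum.cong[OF refl])
      fix A assume A: "A \<in> {A. A \<in> \<A> \<and> A \<subset> B}"
      then have AB: "card A < card B" using finA[OF B] by (auto intro: psubset_card_mono)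
      obtain i where i: "card A = Suc i" using posA[of A] A by (cases "card A") auto
      have eq: "{x. x \<in> B \<and> x \<in> A} = A" using A by auto
      have "real (Suc i) * real (card B choose Suc i) = real (card B) * real ((card B - 1) choose i)"
        using binomial_absorption[of i "card B"] by (metis of_nat_mult)
      moreover have "card B choose Suc i > 0" "(card B - 1) choose i > 0"
        using AB i by (auto simp: zero_less_binomial_iff)
      ultimately show "(\<Sum>x | x \<in> B \<and> x \<in> A. 1 / real ((card B - 1) choose (card A - 1))) =
          real (card B) * (1 / real (card B choose card A))"
        unfolding eq i by (simp add: i field_simps)
    qed
    also have "\<dots> = real (card B) * (\<Sum>A | A \<in> \<A> \<and> A \<subset> B. 1 / real (card B choose card A))"
      by (simp add: sum_distrib_left)
    also have "\<dots> \<le> real (card B) * \<eta>"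
      unfolding \<eta>_def using layers B
      by (intro mult_left_mono proper_subsets_density_le[OF finA[OF B] _ _ sep]) auto
    finally show ?thesis .
  qed

  define s where "s = (\<Sum>A\<in>\<A>. 1 / real (n choose card A))"
  define c where "c = real (n - b) * real (n choose b)"
  have wk: "real (card A) * w (card A) = c / real (n choose card A)" if "A \<in> \<A>" for A
    using posA[OF that] unfolding w_def c_def by simp
  \<comment> \<open>\<open>count\<close> is used twice, with weight 1 and with weight
    \<open>R\<close>, giving c * s \<le> C(n, b) + \<eta> * c * s; the factor C(n, b) then
    cancels.\<close>
  have "c * s = (\<Sum>A\<in>\<A>. w (card A) * (\<Sum>x\<in>A. 1))"
    unfolding s_def sum_distrib_left by (intro sum.cong) (simp_all add: wk)
  also have "\<dots> = (\<Sum>D\<in>\<D>. \<Sum>(A, x)\<in>T D. 1 / real (b choose (card A - 1)))"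
    by (rule count[of "\<lambda>_ _. 1", symmetric])
  also have "\<dots> \<le> (\<Sum>D\<in>\<D>. 1 + (\<Sum>(B, x)\<in>T D. R B x / real (b choose (card B - 1))))"
    by (intro sum_mono chain)
  also have "\<dots> = real (card \<D>) + (\<Sum>B\<in>\<A>. w (card B) * (\<Sum>x\<in>B. R B x))"
    using count[of R] by (simp add: sum.distrib)
  also have "(\<Sum>B\<in>\<A>. w (card B) * (\<Sum>x\<in>B. R B x)) \<le> (\<Sum>B\<in>\<A>. w (card B) * (real (card B) * \<eta>))"
    by (intro sum_mono mult_left_mono R_le) (auto simp: w_def)
  also have "\<dots> = \<eta> * (c * s)"
    unfolding s_def sum_distrib_left
  proof (rule sum.cong[OF refl])
    fix B assume "B \<in> \<A>"
    then have "\<eta> * (real (card B) * w (card B)) = \<eta> * (c * (1 / real (n choose card B)))" by (simp add: wk)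
    then show "w (card B) * (real (card B) * \<eta>) = \<eta> * (c * (1 / real (n choose card B)))" by (simp only: mult_ac)
  qed
  also have "real (card \<D>) = real (n choose b)"
    unfolding \<D>_def using fin V by (simp add: n_subsets)
  finally have "(1 - \<eta>) * real (n - b) * s * real (n choose b) \<le> 1 * real (n choose b)"
    unfolding c_def by (simp add: algebra_simps)
  moreover have "real (n choose b) > 0" using b by (simp add: zero_less_binomial_iff)
  ultimately show ?thesis unfolding \<eta>_def s_def by (simp only: mult_le_cancel_right_pos)
qed

section \<open>Tail estimate and the middle layers\<close>

text \<open>Hoeffding's inequality for the binomial distribution with parameter 1/2 bounds the tail
  relative to \<open>2 ^ n\<close>. The central coefficient is the largest of n + 1 terms with sum
  \<open>2 ^ n\<close>, hence the factor \<open>n + 1\<close>.\<close>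

lemma binomial_tail_le:
  fixes s :: real
  assumes n: "n > 0" and s: "s \<ge> 0"
  shows "real (\<Sum>k | k \<le> n \<and> \<bar>real k - real n / 2\<bar> \<ge> s. n choose k) \<le>
    2 * real (n + 1) * exp (- 2 * s\<^sup>2 / real n) * real (n choose (n div 2))"
proof -
  let ?K = "{k. k \<le> n \<and> \<bar>real k - real n / 2\<bar> \<ge> s}"
  interpret binomial_distribution n "1/2" by unfold_locales auto
  have "measure_pmf.prob (binomial_pmf n (1/2)) ?K \<le>
      measure_pmf.prob (binomial_pmf n (1/2)) {x. \<bar>real x - real n * (1/2)\<bar> \<ge> s}"
    by (intro measure_pmf.finite_measure_mono) auto
  also have "\<dots> \<le> 2 * exp (- 2 * s\<^sup>2 / real n)" by (rule prob_abs_ge[OF n s])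
  also have "measure_pmf.prob (binomial_pmf n (1/2)) ?K = (\<Sum>k\<in>?K. pmf (binomial_pmf n (1/2)) k)"
    by (intro measure_measure_pmf_finite) auto
  also have "\<dots> = (\<Sum>k\<in>?K. real (n choose k) / 2 ^ n)"
    by (intro sum.cong) (auto simp: pmf_binomial power_add[symmetric] power_one_over field_simps)
  finally have "real (\<Sum>k\<in>?K. n choose k) \<le> 2 * exp (- 2 * s\<^sup>2 / real n) * 2 ^ n"
    by (simp add: sum_divide_distrib[symmetric] field_simps)
  also have "2 ^ n \<le> real (n + 1) * real (n choose (n div 2))"
  proof -
    have "(\<Sum>k\<le>n. n choose k) \<le> (\<Sum>k\<le>n. n choose (n div 2))" by (intro sum_mono binomial_maximum)
    then have "2 ^ n \<le> (n + 1) * (n choose (n div 2))" by (simp add: choose_row_sum)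
    then have "real (2 ^ n) \<le> real ((n + 1) * (n choose (n div 2)))" by (simp only: of_nat_le_iff)
    then show ?thesis by (simp only: of_nat_mult of_nat_power of_nat_numeral)
  qed
  finally have "real (\<Sum>k\<in>?K. n choose k) \<le>
      2 * exp (- 2 * s\<^sup>2 / real n) * (real (n + 1) * real (n choose (n div 2)))" by simp
  then show ?thesis by (simp only: mult_ac)
qed

lemma card_le_middle_plus_tail:
  fixes \<A> :: "nat set set" and s :: real
  assumes n: "n > 0" and s: "s \<ge> 0" "3 * s < real n / 2" and \<A>: "\<A> \<subseteq> Pow {1..n}"
    and sep: "\<And>A A'. A \<in> \<A> \<Longrightarrow> A' \<in> \<A> \<Longrightarrow> card (A - A') \<noteq> 1"
  shows "real (card \<A>) \<le> (1 / (real n / 2 - 3 * s) + 2 * real (n + 1) * exp (- 2 * s\<^sup>2 / real n))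
    * real (n choose (n div 2))"
proof -
  define M where "M = {A \<in> \<A>. \<bar>real (card A) - real n / 2\<bar> < s}"
  let ?K = "{k. k \<le> n \<and> \<bar>real k - real n / 2\<bar> \<ge> s}"
  let ?C = "real (n choose (n div 2))"
  have fin\<A>: "finite \<A>" using \<A> by (auto intro: finite_subset)
  have cardA: "card A \<le> n" if "A \<in> \<A>" for A
    using that \<A> card_mono[of "{1..n}" A] by auto
  have tail: "real (card (\<A> - M)) \<le> 2 * real (n + 1) * exp (- 2 * s\<^sup>2 / real n) * ?C"
  proof -
    have "\<A> - M \<subseteq> (\<Union>k\<in>?K. {A. A \<subseteq> {1..n} \<and> card A = k})"
      using \<A> cardA by (auto simp: M_def)
    then have "card (\<A> - M) \<le> card (\<Union>k\<in>?K. {A. A \<subseteq> {1..n} \<and> card A = k})"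
      by (intro card_mono finite_UN_I) auto
    also have "\<dots> \<le> (\<Sum>k\<in>?K. card {A. A \<subseteq> {1..n} \<and> card A = k})"
      by (intro card_UN_le) auto
    also have "\<dots> = (\<Sum>k\<in>?K. n choose k)" by (simp add: n_subsets)
    finally have "real (card (\<A> - M)) \<le> real (\<Sum>k\<in>?K. n choose k)" by (simp only: of_nat_le_iff)
    also have "\<dots> \<le> 2 * real (n + 1) * exp (- 2 * s\<^sup>2 / real n) * ?C" by (rule binomial_tail_le[OF n s(1)])
    finally show ?thesis .
  qed
  have mid: "real (card M) \<le> 1 / (real n / 2 - 3 * s) * ?C"
  proof -
    define m where "m = real n / 2"
    define a where "a = nat \<lceil>m - s\<rceil>"
    define b where "b = nat \<lfloor>m + s\<rfloor>"
    define S where "S = (\<Sum>A\<in>M. 1 / real (n choose card A))"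
    have ms: "3 * s < m" "m > 0" and n2: "real n = 2 * m" using n s by (auto simp: m_def)
    have a: "real a \<ge> m - s" "a \<ge> 1" using ms s by (auto simp: a_def) linarith+
    have b: "real b \<le> m + s" using ms s by (auto simp: b_def)
    have bn: "b < n" using b ms n2 s by linarith
    show ?thesis
    proof (cases "M = {}")
      case True
      then show ?thesis using s by simp
    next
      case False
      have layers: "a \<le> card A \<and> card A \<le> b" if "A \<in> M" for A
      proof -
        have "m - s \<le> real (card A)" "real (card A) \<le> m + s"
          using that by (auto simp: M_def m_def abs_if split: if_splits)
        then show ?thesis unfolding a_def b_def by (auto simp: nat_le_iff le_nat_iff ceiling_le_iff le_floor_iff)
      qed
      then have ab: "a \<le> b" using False by fastforce
      have "(1 - real (b - a) / real (a + 1)) * real (n - b) * S \<le> 1"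
        unfolding S_def
        by (rule reciprocal_binomial_sum_le[of "{1..n}", OF _ _ _ a(2) ab bn layers])
          (use \<A> sep in \<open>auto simp: M_def\<close>)
      \<comment> \<open>The window has width at most 2s and starts at m - s or later, so the first
        factor is at least 1 - 2s / (m - s) = (m - 3s) / (m - s); the second is at least m - s. This
        is the source of the 3s.\<close>
      moreover have "m - 3 * s \<le> (1 - real (b - a) / real (a + 1)) * real (n - b)"
      proof -
        have "real (b - a) / real (a + 1) \<le> 2 * s / (m - s)"
          using a b ab ms s by (intro frac_le) auto
        then have "1 - 2 * s / (m - s) \<le> 1 - real (b - a) / real (a + 1)" by simp
        moreover have "m - s \<le> real (n - b)" using b bn n2 by simp
        moreover have "0 \<le> (m - 3 * s) / (m - s)" using ms s by simp
        moreover have "1 - 2 * s / (m - s) = (m - 3 * s) / (m - s)" using ms s by (simp add: field_simps)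
        ultimately have "(m - 3 * s) / (m - s) * (m - s) \<le> (1 - real (b - a) / real (a + 1)) * real (n - b)"
          using ms s by (intro mult_mono) linarith+
        moreover have "(m - 3 * s) / (m - s) * (m - s) = m - 3 * s" using ms s by simp
        ultimately show ?thesis by (simp only:)
      qed
      moreover have S0: "S \<ge> 0" unfolding S_def by (intro sum_nonneg) auto
      ultimately have "(m - 3 * s) * S \<le> 1" by (meson mult_right_mono order_trans)
      then have "S \<le> 1 / (m - 3 * s)" using ms by (simp add: field_simps)
      moreover have "real (card M) / ?C \<le> S"
      proof -
        have "(\<Sum>A\<in>M. 1 / ?C) \<le> S"
          unfolding S_def
        proof (rule sum_mono)
          fix A assume "A \<in> M"
          then have "n choose card A > 0" using cardA by (auto simp: M_def zero_less_binomial_iff)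
          then show "1 / ?C \<le> 1 / real (n choose card A)"
            using binomial_maximum[of n "card A"] by (intro divide_left_mono) auto
        qed
        then show ?thesis by simp
      qed
      moreover have "?C > 0" by (simp add: zero_less_binomial_iff)
      ultimately have "real (card M) / ?C \<le> 1 / (m - 3 * s)" by linarith
      then have "real (card M) \<le> 1 / (m - 3 * s) * ?C" using \<open>?C > 0\<close> by (simp only: pos_divide_le_eq)
      then show ?thesis unfolding m_def .
    qed
  qed
  have "\<A> = M \<union> (\<A> - M)" by (auto simp: M_def)
  then have "real (card \<A>) \<le> real (card M) + real (card (\<A> - M))"
    using card_Un_le[of M "\<A> - M"] by (metis of_nat_add of_nat_le_iff)
  then show ?thesis using mid tail by (simp add: algebra_simps)
qed

section \<open>Choice of the window and of the error term\<close>

theorem theorem2: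
  shows "\<exists>\<epsilon> :: nat \<Rightarrow> real. \<epsilon> \<longlonglongrightarrow> 0 \<and>
    (\<forall>n::nat. n \<ge> 1 \<longrightarrow>
      (\<forall>\<A> :: nat set set. \<A> \<subseteq> Pow {1..n} \<longrightarrow>
        (\<forall>A\<in>\<A>. \<forall>B\<in>\<A>. card (A - B) \<noteq> 1) \<longrightarrow>
        real (card \<A>) \<le> (2 + \<epsilon> n) / real n * real (n choose (n div 2))))"
proof -
  \<comment> \<open>The exponent 3/4 makes s / n tend to 0, while s^2 / n = n^(1/2) grows fast
    enough for the exponential to beat the factor n * (n + 1).\<close>
  define s :: "nat \<Rightarrow> real" where "s n = real n powr (3/4)" for n
  \<comment> \<open>\<open>e\<close> is chosen so that (2 + e n) / n is exactly the coefficient from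
    \<open>card_le_middle_plus_tail\<close>.\<close>
  define e :: "nat \<Rightarrow> real" where
    "e n = real n / (real n / 2 - 3 * s n) + 2 * real n * real (n + 1) * exp (- 2 * (s n)\<^sup>2 / real n) - 2" for n
  \<comment> \<open>Only finitely many n violate the window condition; for them the value n * 2^n
    reduces the claim to the trivial bound |\<A>| \<le> 2^n.\<close>
  define \<epsilon> where "\<epsilon> n = (if 3 * s n < real n / 2 then e n else real n * 2 ^ n)" for n
  have "eventually (\<lambda>n. 3 * s n < real n / 2) sequentially"
    unfolding s_def by real_asymp
  then have "eventually (\<lambda>n. e n = \<epsilon> n) sequentially"
    by eventually_elim (simp add: \<epsilon>_def)
  moreover have "e \<longlonglongrightarrow> 0"
    unfolding e_def s_def by real_asymp
  ultimately have "\<epsilon> \<longlonglongrightarrow> 0" by (metis (mono_tags, lifting) Lim_transform_eventually)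
  moreover have "real (card \<A>) \<le> (2 + \<epsilon> n) / real n * real (n choose (n div 2))"
    if n: "n \<ge> 1" and \<A>: "\<A> \<subseteq> Pow {1..n}" and sep: "\<forall>A\<in>\<A>. \<forall>B\<in>\<A>. card (A - B) \<noteq> 1"
    for n and \<A> :: "nat set set"
  proof (cases "3 * s n < real n / 2")
    case True
    have "real (card \<A>) \<le> (1 / (real n / 2 - 3 * s n) + 2 * real (n + 1) * exp (- 2 * (s n)\<^sup>2 / real n))
        * real (n choose (n div 2))"
      using n sep by (intro card_le_middle_plus_tail[OF _ _ True \<A>]) (auto simp: s_def)
    also have "1 / (real n / 2 - 3 * s n) + 2 * real (n + 1) * exp (- 2 * (s n)\<^sup>2 / real n) = (2 + \<epsilon> n) / real n"
      using n True by (simp add: \<epsilon>_def e_def add_divide_distrib)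
    finally show ?thesis .
  next
    case False
    have "card \<A> \<le> 2 ^ n" using card_mono[OF _ \<A>] by (simp add: card_Pow)
    then have "real (card \<A>) \<le> 2 ^ n" by (metis of_nat_le_iff of_nat_numeral of_nat_power)
    also have "(2::real) ^ n = real n * 2 ^ n / real n * 1" using n by simp
    also have "\<dots> \<le> (2 + \<epsilon> n) / real n * real (n choose (n div 2))"
      using False n by (intro mult_mono divide_right_mono) (auto simp: \<epsilon>_def Suc_le_eq zero_less_binomial_iff)
    finally show ?thesis .
  qed
  ultimately show ?thesis by (intro exI[of _ \<epsilon>] conjI allI impI)
qed

end
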